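(* Let $(X,\|\cdot\|)$ be a real Banach space with $\dim X>1$, let $\tau_{\|\cdot\|}$ be its norm topology, and let $\rho$ be the projective equivalence relation on $X\setminus\{0\}$. Let $\mathcal{F}=S_{X^*}$ be the set of all norm-one continuous linear functionals on $X$. Then there exists a $\rho$-admissible subset $\mathcal{A}_X$ of $X$ such that $\mathcal{P}_{(\tau_{\|\cdot\|},\mathcal{F},\mathcal{A}_X)}\subsetneq\mathcal{P}_B$. In particular, Birkhoff-James orthogonality is not equivalent to $\perp_{(\tau_{\|\cdot\|},\mathcal{F},\mathcal{A}_X)}$.
   Context: Projective relation: for $u,v\in X\setminus\{0\}$, $u\,\rho\,v$ iff $u=tv$ for some non-zero $t\in\mathbb{R}$. A subset $\mathcal{A}_X\subset X$ is $\rho$-admissible if it consists of exactly one element from each equivalence class of $\rho$. For non-zero $x\in X$, $a_x$ denotes the unique element of $\mathcal{A}_X$ equivalent to $x$. Orthogonality: let $\tau$ be a topology on $X$, $\mathcal{F}$ a family of continuous functions $(X,\tau)\to\mathbb{R}$ (with $\mathbb{R}$ carrying the usual topology), and $\mathcal{A}_X$ a $\rho$-admissible set. For $u,v\in\mathcal{A}_X$, $u\perp_{(\tau,\mathcal{F},\mathcal{A}_X)}v$ means that there is $f\in\mathcal{F}$ with (i) $f(u)=\sup_{z\in\mathcal{A}_X}|f(z)|$ and (ii) $f(\lambda v)=0$ for all $\lambda\in\mathbb{R}$. For non-zero $x,y\in X$, $x\perp_{(\tau,\mathcal{F},\mathcal{A}_X)}y$ means $a_x\perp_{(\tau,\mathcal{F},\mathcal{A}_X)}a_y$.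 If $x=0$ or $y=0$, then $x\perp_{(\tau,\mathcal{F},\mathcal{A}_X)}y$ holds by definition. Put $\mathcal{P}_{(\tau,\mathcal{F},\mathcal{A}_X)}=\{(x,y)\in X\times X: x\perp_{(\tau,\mathcal{F},\mathcal{A}_X)}y\}$. Birkhoff-James orthogonality in $(X,\|\cdot\|)$: $x\perp_B y$ iff $\|x\|\le\|x+\lambda y\|$ for all $\lambda\in\mathbb{R}$; $\mathcal{P}_B=\{(x,y)\in X\times X: x\perp_B y\}$. *)

theory Defs
  imports "HOL-Analysis.Analysis"
begin

definition proj_rel :: "('a::real_vector \<times> 'a) set" where
  "proj_rel = {(u, v). u \<noteq> 0 \<and> v \<noteq> 0 \<and> (\<exists>t. t \<noteq> 0 \<and> u = t *\<^sub>R v)}"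

lemma equiv_proj_rel: "equiv (- {0}) (proj_rel :: ('a::real_vector \<times> 'a) set)"
proof (rule equivI)
  show "proj_rel \<subseteq> (- {0 :: 'a}) \<times> (- {0})"
    by (auto simp: proj_rel_def)
  show "refl_on (- {0 :: 'a}) proj_rel"
    by (auto simp: refl_on_def proj_rel_def intro!: exI[of _ 1])
  show "sym (proj_rel :: ('a \<times> 'a) set)"
  proof (rule symI)
    fix u v :: 'a
    assume "(u, v) \<in> proj_rel"
    then obtain t where "u \<noteq> 0" "v \<noteq> 0" "t \<noteq> 0" "u = t *\<^sub>R v"
      by (auto simp: proj_rel_def)
    then show "(v, u) \<in> proj_rel"
      by (auto simp: proj_rel_def intro!: exI[of _ "inverse t"])
  qed
  show "trans (proj_rel :: ('a \<times> 'a) set)"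
  proof (rule transI)
    fix u v w :: 'a
    assume "(u, v) \<in> proj_rel" "(v, w) \<in> proj_rel"
    then obtain s t where "u \<noteq> 0" "w \<noteq> 0" "s \<noteq> 0" "t \<noteq> 0" "u = s *\<^sub>R v" "v = t *\<^sub>R w"
      by (auto simp: proj_rel_def)
    then show "(u, w) \<in> proj_rel"
      by (auto simp: proj_rel_def intro!: exI[of _ "s * t"])
  qed
qed

definition admissible :: "'a::real_vector set \<Rightarrow> bool" where
  "admissible A \<longleftrightarrow> A \<subseteq> - {0} \<and> (\<forall>C \<in> (- {0}) // proj_rel. \<exists>!a. a \<in> A \<inter> C)"

definition representative :: "'a::real_vector set \<Rightarrow> 'a \<Rightarrow> 'a" where
  "representative A x = (THE a. a \<in> A \<and> (a, x) \<in> proj_rel)"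

text \<open>
  The supremum is taken in the extended reals: it may be infinite, and then no real value \<open>f u\<close>
  equals it, whereas the real-valued \<open>SUP\<close> of an unbounded set is unspecified.
  The continuity clause is where the topology \<open>\<tau>\<close> enters; it is redundant for a family
  \<open>F\<close> of \<open>\<tau>\<close>-continuous functions, the only families intended here.
\<close>

definition rep_orthogonal ::
  "'a::real_vector topology \<Rightarrow> ('a \<Rightarrow> real) set \<Rightarrow> 'a set \<Rightarrow> 'a \<Rightarrow> 'a \<Rightarrow> bool" where
  "rep_orthogonal \<tau> F A u v \<longleftrightarrow>
     (\<exists>f\<in>F. continuous_map \<tau> euclideanreal f
        \<and> ereal (f u) = (SUP z\<in>A. ereal \<bar>f z\<bar>)
        \<and> (\<forall>c::real. f (c *\<^sub>R v) = 0))"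

definition orthogonal_wrt ::
  "'a::real_vector topology \<Rightarrow> ('a \<Rightarrow> real) set \<Rightarrow> 'a set \<Rightarrow> 'a \<Rightarrow> 'a \<Rightarrow> bool" where
  "orthogonal_wrt \<tau> F A x y \<longleftrightarrow>
     x = 0 \<or> y = 0 \<or> rep_orthogonal \<tau> F A (representative A x) (representative A y)"

definition orthogonal_pairs ::
  "'a::real_vector topology \<Rightarrow> ('a \<Rightarrow> real) set \<Rightarrow> 'a set \<Rightarrow> ('a \<times> 'a) set" where
  "orthogonal_pairs \<tau> F A = {(x, y). orthogonal_wrt \<tau> F A x y}"

definition birkhoff_james :: "'a::real_normed_vector \<Rightarrow> 'a \<Rightarrow> bool" where
  "birkhoff_james x y \<longleftrightarrow> (\<forall>c::real. norm x \<le> norm (x + c *\<^sub>R y))"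

definition birkhoff_james_pairs :: "('a::real_normed_vector \<times> 'a) set" where
  "birkhoff_james_pairs = {(x, y). birkhoff_james x y}"

definition dual_unit_sphere :: "('a::real_normed_vector \<Rightarrow> real) set" where
  "dual_unit_sphere = blinfun_apply ` {f. norm f = 1}"

lemma dual_unit_sphere_continuous:
  "f \<in> dual_unit_sphere \<Longrightarrow> continuous_map euclidean euclideanreal f"
  by (auto simp: dual_unit_sphere_def intro!: continuous_intros)

end

(*
  Take x0 of norm one and y0 independent of x0 with x0 Birkhoff-James orthogonal to y0, where x0
  is a multiple of a nearest point to 0 on a line avoiding 0. Represent every class by a unit
  vector, except that x0 is represented by x0/2. If f vanishes at y and attains its supremum over
  the representatives at the representative s x of x, then the representative r (x + c y)
  satisfies |r| <= |s|. This gives ||x|| <= ||x + c y|| for all c but the at most one for which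
  x + c y is on the line of x0, hence for all c by continuity. On the other hand x0 is not
  orthogonal to y0 for these representatives, since x0 + c y0 for small c would have a
  representative that is too long.
*)
theory Submission imports Defs begin

section \<open>Birkhoff-James orthogonality from nearest points on a line\<close>

text \<open>For independent \<open>a\<close> and \<open>b\<close>, a point \<open>w\<close> of least
  norm on the line \<open>a + c b\<close> exists and is non-zero. Minimality along direction
  \<open>b\<close> is precisely Birkhoff-James orthogonality of \<open>w\<close> to
  \<open>b\<close>, and it survives normalising \<open>w\<close>.\<close>

lemma ex_birkhoff_james_unit:
  fixes B :: "'a::real_normed_vector set"
  assumes "independent B" "finite B \<longrightarrow> card B > 1"
  obtains x y :: 'a where "norm x = 1" "y \<noteq> 0" "\<And>t. y \<noteq> t *\<^sub>R x" "birkhoff_james x y"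
proof -
  have "\<exists>a b. a \<in> B \<and> b \<in> B \<and> a \<noteq> b"
  proof (cases "finite B")
    case True
    then show ?thesis
      using assms(2) by (metis One_nat_def card_le_Suc0_iff_eq not_less)
  next
    case False
    then obtain a where "a \<in> B" by fastforce
    moreover from False have "infinite (B - {a})" by simp
    then obtain b where "b \<in> B - {a}" by (metis ex_in_conv finite.emptyI)
    ultimately show ?thesis by blast
  qed
  then obtain a b where ab: "a \<in> B" "b \<in> B" "a \<noteq> b" by blast
  have b0: "b \<noteq> 0" using assms(1) ab dependent_zero by blast
  have a_notin: "a \<noteq> t *\<^sub>R b" for t
  proof
    assume "a = t *\<^sub>R b"
    then have "a \<in> span (B - {a})"
      using ab by (simp add: span_base span_scale)
    then show False using assms(1) ab(1) dependent_def by blast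
  qed
  \<comment> \<open>For |d| at least \<open>R\<close> the norm of \<open>a + d b\<close> is at least
    |d| \<open>norm b\<close> - \<open>norm a\<close>, hence at least \<open>norm a\<close>, its
    value at d = 0. A minimum over the compact interval is therefore global.\<close>
  define R where "R = 2 * norm a / norm b"
  have "R \<ge> 0" by (simp add: R_def)
  then have "\<exists>c\<in>{-R..R}. \<forall>d\<in>{-R..R}. norm (a + c *\<^sub>R b) \<le> norm (a + d *\<^sub>R b)"
    by (intro continuous_attains_inf continuous_intros) auto
  then obtain c where c: "\<And>d. d \<in> {-R..R} \<Longrightarrow> norm (a + c *\<^sub>R b) \<le> norm (a + d *\<^sub>R b)"
    by blast
  have c_min: "norm (a + c *\<^sub>R b) \<le> norm (a + d *\<^sub>R b)" for d
  proof (cases "d \<in> {-R..R}")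
    case False
    then have "\<bar>d\<bar> \<ge> R" by auto
    then have "2 * norm a \<le> \<bar>d\<bar> * norm b"
      using b0 by (simp add: R_def field_simps)
    also have "\<dots> = norm ((a + d *\<^sub>R b) - a)" by simp
    also have "\<dots> \<le> norm (a + d *\<^sub>R b) + norm a" by (rule norm_triangle_ineq4)
    finally have "norm a \<le> norm (a + d *\<^sub>R b)" by simp
    moreover have "norm (a + c *\<^sub>R b) \<le> norm a"
      using c[of 0] \<open>R \<ge> 0\<close> by simp
    ultimately show ?thesis by simp
  qed (use c in blast)
  define w where "w = a + c *\<^sub>R b"
  have w0: "w \<noteq> 0"
    using a_notin[of "- c"] by (auto simp: w_def eq_neg_iff_add_eq_0)
  show thesis
  proof
    show "norm (w /\<^sub>R norm w) = 1" using w0 by simp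
    show "b \<noteq> 0" by (rule b0)
    show "b \<noteq> t *\<^sub>R (w /\<^sub>R norm w)" for t
    proof
      assume *: "b = t *\<^sub>R (w /\<^sub>R norm w)"
      then have "t \<noteq> 0" using b0 by auto
      then have "w = (norm w / t) *\<^sub>R b"
        using * w0 by simp
      then have "a = (norm w / t - c) *\<^sub>R b"
        by (simp add: w_def algebra_simps)
      then show False using a_notin by blast
    qed
    show "birkhoff_james (w /\<^sub>R norm w) b"
      unfolding birkhoff_james_def
    proof
      fix d :: real
      have "w /\<^sub>R norm w + d *\<^sub>R b = (w + (d * norm w) *\<^sub>R b) /\<^sub>R norm w"
        using w0 by (simp add: scaleR_add_right)
      then have "norm (w /\<^sub>R norm w + d *\<^sub>R b) = norm (w + (d * norm w) *\<^sub>R b) / norm w"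
        by (simp add: divide_inverse)
      moreover have "norm w \<le> norm (w + (d * norm w) *\<^sub>R b)"
        using c_min[of "c + d * norm w"] by (simp add: w_def algebra_simps)
      ultimately show "norm (w /\<^sub>R norm w) \<le> norm (w /\<^sub>R norm w + d *\<^sub>R b)"
        using w0 by simp
    qed
  qed
qed

section \<open>Representatives and the construction of an admissible set\<close>

lemma representative_eq:
  assumes "admissible A" "x \<noteq> 0"
  shows "representative A x \<in> A" "(representative A x, x) \<in> proj_rel"
    and "a \<in> A \<Longrightarrow> (a, x) \<in> proj_rel \<Longrightarrow> representative A x = a"
proof -
  have "proj_rel `` {x} \<in> (- {0}) // proj_rel"
    using assms(2) by (simp add: quotientI)
  then have "\<exists>!a. a \<in> A \<inter> proj_rel `` {x}"
    using assms(1) unfolding admissible_def by (elim conjE bspec)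
  \<comment> \<open>Symmetry turns membership in the class of \<open>x\<close> into the orientation
    used by \<open>representative\<close>.\<close>
  moreover have "a \<in> proj_rel `` {x} \<longleftrightarrow> (a, x) \<in> proj_rel" for a
    using equiv_proj_rel by (auto dest: symD elim: equivE)
  ultimately have ex1: "\<exists>!a. a \<in> A \<and> (a, x) \<in> proj_rel" by simp
  from theI'[OF ex1] show "representative A x \<in> A" "(representative A x, x) \<in> proj_rel"
    by (simp_all add: representative_def)
  show "representative A x = a" if "a \<in> A" "(a, x) \<in> proj_rel"
    unfolding representative_def using ex1 that by (blast intro: the1_equality)
qed

lemma admissible_scaleR:
  assumes "admissible A" "x \<noteq> 0"
  obtains r where "r \<noteq> 0" "r *\<^sub>R x \<in> A" "representative A x = r *\<^sub>R x"
  using representative_eq(1,2)[OF assms] by (auto simp: proj_rel_def)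

text \<open>Every class contains a unit vector, so unit vectors can be chosen for all classes but
  that of \<open>x0\<close>. The last conclusion also records that half of \<open>x0\<close> is the
  only chosen point on the line of \<open>x0\<close>.\<close>

lemma ex_admissible_half:
  fixes x0 :: "'a::real_normed_vector"
  assumes "x0 \<noteq> 0"
  obtains A where "admissible A" "(1/2) *\<^sub>R x0 \<in> A"
    "\<And>a. a \<in> A \<Longrightarrow> a = (1/2) *\<^sub>R x0 \<or> norm a = 1 \<and> (\<forall>t. a \<noteq> t *\<^sub>R x0)"
proof -
  \<comment> \<open>Choosing per class rather than per vector ensures that equivalent vectors share
    one representative.\<close>
  define g where "g C = (if x0 \<in> C then (1/2) *\<^sub>R x0 else SOME a. a \<in> C \<and> norm a = 1)" for C
  define A where "A = g ` ((- {0}) // proj_rel)"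
  have half: "((1/2) *\<^sub>R x0, x0) \<in> proj_rel" "(x0, (1/2) *\<^sub>R x0) \<in> proj_rel"
    using assms by (auto simp: proj_rel_def intro: exI[of _ "1/2"] exI[of _ 2])
  have g_unit: "g C \<in> C \<and> norm (g C) = 1" if C: "C \<in> (- {0}) // proj_rel" "x0 \<notin> C" for C
  proof -
    obtain x where x: "x \<in> - {0}" "C = proj_rel `` {x}"
      using C(1) by (rule quotientE)
    then have "x /\<^sub>R norm x \<in> C" "norm (x /\<^sub>R norm x) = 1"
      by (auto simp: proj_rel_def intro: exI[of _ "norm x"])
    then have "\<exists>a. a \<in> C \<and> norm a = 1" by blast
    then have "(SOME a. a \<in> C \<and> norm a = 1) \<in> C \<and> norm (SOME a. a \<in> C \<and> norm a = 1) = 1"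
      by (rule someI_ex)
    then show ?thesis using C(2) by (simp add: g_def)
  qed
  have g_in: "g C \<in> C" if C: "C \<in> (- {0}) // proj_rel" for C
  proof (cases "x0 \<in> C")
    case True
    then show ?thesis
      using in_quotient_imp_closed[OF equiv_proj_rel C True half(2)] by (simp add: g_def)
  qed (use g_unit C in blast)
  have sub: "C \<subseteq> - {0}" if "C \<in> (- {0}) // proj_rel" for C :: "'a set"
    using that by (auto elim!: quotientE simp: proj_rel_def)
  show thesis
  proof
    show "admissible A"
      unfolding admissible_def
    proof (intro conjI ballI)
      show "A \<subseteq> - {0}"
        unfolding A_def using g_in sub by (meson image_subsetI subsetD)
    next
      fix C :: "'a set" assume C: "C \<in> (- {0}) // proj_rel"
      show "\<exists>!a. a \<in> A \<inter> C"
      proof (rule ex1I[of _ "g C"])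
        show "g C \<in> A \<inter> C" using C g_in by (auto simp: A_def)
      next
        fix a assume a: "a \<in> A \<inter> C"
        then obtain D where D: "D \<in> (- {0}) // proj_rel" "a = g D" by (auto simp: A_def)
        then have "a \<in> D" using g_in by simp
        \<comment> \<open>Distinct classes are disjoint, and \<open>a\<close> lies in both
          \<open>C\<close> and \<open>D\<close>.\<close>
        then have "C = D"
          using quotient_disj[OF equiv_proj_rel C D(1)] a by auto
        then show "a = g C" using D by simp
      qed
    qed
    let ?C = "proj_rel `` {x0}"
    have "?C \<in> (- {0}) // proj_rel"
      using assms by (intro quotientI) simp
    then have "g ?C \<in> A" unfolding A_def by (rule imageI)
    moreover have "x0 \<in> ?C"
      by (rule equiv_class_self[OF equiv_proj_rel]) (use assms in simp)
    then have "g ?C = (1/2) *\<^sub>R x0" by (simp add: g_def)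
    ultimately show "(1/2) *\<^sub>R x0 \<in> A" by simp
  next
    fix a assume "a \<in> A"
    then obtain C where C: "C \<in> (- {0}) // proj_rel" "a = g C" by (auto simp: A_def)
    show "a = (1/2) *\<^sub>R x0 \<or> norm a = 1 \<and> (\<forall>t. a \<noteq> t *\<^sub>R x0)"
    proof (cases "x0 \<in> C")
      case False
      have "a \<noteq> t *\<^sub>R x0" for t
      proof
        assume *: "a = t *\<^sub>R x0"
        moreover have "a \<in> C" using C g_in by simp
        moreover have "a \<noteq> 0" using sub[OF C(1)] \<open>a \<in> C\<close> by auto
        ultimately have "(a, x0) \<in> proj_rel" using assms by (auto simp: proj_rel_def)
        then show False
          using in_quotient_imp_closed[OF equiv_proj_rel C(1) \<open>a \<in> C\<close>] False by blast
      qed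
      then show ?thesis using g_unit C False by blast
    qed (simp add: C g_def)
  qed
qed

section \<open>Comparison with Birkhoff-James orthogonality\<close>

text \<open>The functional \<open>f\<close> witnessing orthogonality vanishes at \<open>y\<close>,
  so it is constant on the line \<open>x + c y\<close>. Its absolute value at a point
  \<open>r (x + c y)\<close> of \<open>A\<close> is |r| |f x|, which cannot exceed the supremum,
  attained at \<open>s x\<close>; dividing by |f x| compares the scale factors.\<close>

lemma orthogonal_representative_scale_le:
  fixes x y :: "'a::real_normed_vector"
  assumes A: "admissible A" and nz: "x \<noteq> 0" "y \<noteq> 0"
    and orth: "orthogonal_wrt euclidean dual_unit_sphere A x y"
    and s: "representative A x = s *\<^sub>R x"
  obtains f :: "'a \<Rightarrow> real" where "linear f" "f x \<noteq> 0" "f y = 0"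
    "\<And>c r. r *\<^sub>R (x + c *\<^sub>R y) \<in> A \<Longrightarrow> \<bar>r\<bar> \<le> \<bar>s\<bar>"
proof -
  obtain t where t: "t \<noteq> 0" "representative A y = t *\<^sub>R y"
    using admissible_scaleR[OF A nz(2)] by blast
  from orth nz s t obtain \<phi> :: "'a \<Rightarrow>\<^sub>L real" where \<phi>: "norm \<phi> = 1"
    and sup: "ereal (\<phi> (s *\<^sub>R x)) = (SUP z\<in>A. ereal \<bar>\<phi> z\<bar>)"
    and zero: "\<And>c. \<phi> (c *\<^sub>R t *\<^sub>R y) = 0"
    by (auto simp: orthogonal_wrt_def rep_orthogonal_def dual_unit_sphere_def)
  have lin: "linear \<phi>"
    by (rule bounded_linear.linear) (rule blinfun.bounded_linear_right)
  have le: "\<bar>\<phi> z\<bar> \<le> \<bar>s\<bar> * \<bar>\<phi> x\<bar>" if "z \<in> A" for z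
  proof -
    \<comment> \<open>The extended supremum equals a real number here, so it bounds the functional
      on all of \<open>A\<close>.\<close>
    have "ereal \<bar>\<phi> z\<bar> \<le> ereal (\<phi> (s *\<^sub>R x))"
      unfolding sup using that by (rule SUP_upper)
    then have "\<bar>\<phi> z\<bar> \<le> s * \<phi> x" by (simp add: blinfun.scaleR_right)
    also have "\<dots> \<le> \<bar>s\<bar> * \<bar>\<phi> x\<bar>" by (metis abs_ge_self abs_mult)
    finally show ?thesis .
  qed
  have y: "\<phi> y = 0" using zero[of "1 / t"] t by simp
  \<comment> \<open>Otherwise \<open>le\<close> makes the functional vanish on \<open>A\<close>,
    which meets every line through 0, contradicting norm one.\<close>
  have x: "\<phi> x \<noteq> 0"
  proof
    assume 0: "\<phi> x = 0"
    have "\<phi> z = 0" for z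
    proof (cases "z = 0")
      case False
      then obtain r where "r \<noteq> 0" "r *\<^sub>R z \<in> A"
        using admissible_scaleR[OF A] by blast
      then show ?thesis using le[of "r *\<^sub>R z"] 0 by (simp add: blinfun.scaleR_right)
    qed simp
    then have "\<phi> = 0" by (intro blinfun_eqI) simp
    then show False using \<phi> by simp
  qed
  show thesis
  proof
    show "\<bar>r\<bar> \<le> \<bar>s\<bar>" if "r *\<^sub>R (x + c *\<^sub>R y) \<in> A" for c r
      using le[OF that] x y
      by (simp add: blinfun.scaleR_right blinfun.add_right abs_mult)
  qed (rule lin x y)+
qed

lemma orthogonal_imp_birkhoff_james:
  fixes x0 :: "'a::real_normed_vector"
  assumes A: "admissible A" and x0: "norm x0 = 1"
    and A_cases: "\<And>a. a \<in> A \<Longrightarrow> a = (1/2) *\<^sub>R x0 \<or> norm a = 1 \<and> (\<forall>t. a \<noteq> t *\<^sub>R x0)"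
    and orth: "orthogonal_wrt euclidean dual_unit_sphere A x y"
  shows "birkhoff_james x y"
proof (cases "x = 0 \<or> y = 0")
  case True
  then show ?thesis by (auto simp: birkhoff_james_def)
next
  case False
  then have nz: "x \<noteq> 0" "y \<noteq> 0" by auto
  obtain s where s: "s \<noteq> 0" "s *\<^sub>R x \<in> A" "representative A x = s *\<^sub>R x"
    using admissible_scaleR[OF A nz(1)] by blast
  obtain f :: "'a \<Rightarrow> real" where f: "linear f" "f x \<noteq> 0" "f y = 0"
    and le: "\<And>c r. r *\<^sub>R (x + c *\<^sub>R y) \<in> A \<Longrightarrow> \<bar>r\<bar> \<le> \<bar>s\<bar>"
    using orthogonal_representative_scale_le[OF A nz orth s(3)] by blast
  have f_line: "f (x + c *\<^sub>R y) = f x" for c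
    using f by (simp add: linear_add linear_scale)
  \<comment> \<open>Only an inequality: \<open>s x\<close> has norm 1/2 when \<open>x\<close> lies
    on the line of \<open>x0\<close>. The equality with 1 is required only for the representative of
    \<open>x + c y\<close>.\<close>
  have s_le: "\<bar>s\<bar> * norm x \<le> 1"
  proof -
    have "norm (s *\<^sub>R x) \<le> 1"
      using A_cases[OF s(2)] x0 by (elim disjE) simp_all
    then show ?thesis by simp
  qed
  have off_line: "norm x \<le> norm (x + c *\<^sub>R y)" if "\<And>t. x + c *\<^sub>R y \<noteq> t *\<^sub>R x0" for c
  proof -
    have "x + c *\<^sub>R y \<noteq> 0" using that[of 0] by simp
    then obtain r where r: "r \<noteq> 0" "r *\<^sub>R (x + c *\<^sub>R y) \<in> A"
      using admissible_scaleR[OF A] by blast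
    have "r *\<^sub>R (x + c *\<^sub>R y) \<noteq> (1/2) *\<^sub>R x0"
      using that r(1) by (metis eq_vector_fraction_iff)
    then have "\<bar>s\<bar> * norm x \<le> \<bar>r\<bar> * norm (x + c *\<^sub>R y)"
      using A_cases[OF r(2)] s_le by (metis norm_scaleR)
    also have "\<dots> \<le> \<bar>s\<bar> * norm (x + c *\<^sub>R y)"
      using le[OF r(2)] by (simp add: mult_right_mono)
    finally show ?thesis using s by simp
  qed
  have "norm x \<le> norm (x + c *\<^sub>R y)" for c
  proof (cases "\<exists>t. x + c *\<^sub>R y = t *\<^sub>R x0")
    case True
    then obtain t where t: "x + c *\<^sub>R y = t *\<^sub>R x0" by blast
    have "f x0 \<noteq> 0"
      using f_line[of c] t f by (auto simp: linear_scale)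
    \<comment> \<open>\<open>f\<close> is constant on the line \<open>x + c y\<close> but injective
      on multiples of \<open>x0\<close>, so the two lines meet in at most one point and every other
      parameter falls under \<open>off_line\<close>.\<close>
    have near: "norm x \<le> norm (x + (c + d) *\<^sub>R y)" if "d \<noteq> 0" for d
    proof (rule off_line)
      fix t' show "x + (c + d) *\<^sub>R y \<noteq> t' *\<^sub>R x0"
      proof
        assume *: "x + (c + d) *\<^sub>R y = t' *\<^sub>R x0"
        then have "t' * f x0 = t * f x0"
          using f_line[of c] f_line[of "c + d"] t f by (simp add: linear_scale)
        then have "t' = t" using \<open>f x0 \<noteq> 0\<close> by simp
        then have "x + (c + d) *\<^sub>R y = x + c *\<^sub>R y" using * t by simp
        then show False using that nz by simp
      qed
    qed
    show ?thesis
    proof (rule field_le_epsilon)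
      fix e :: real assume "e > 0"
      \<comment> \<open>A shift by \<open>d y\<close> has norm \<open>e\<close>, so it leaves the
        exceptional point at a cost of at most \<open>e\<close> in norm.\<close>
      define d where "d = e / norm y"
      have "norm x \<le> norm ((x + c *\<^sub>R y) + d *\<^sub>R y)"
        using near[of d] \<open>e > 0\<close> nz by (simp add: d_def algebra_simps)
      also have "\<dots> \<le> norm (x + c *\<^sub>R y) + norm (d *\<^sub>R y)" by (rule norm_triangle_ineq)
      also have "norm (d *\<^sub>R y) = e" using \<open>e > 0\<close> nz by (simp add: d_def)
      finally show "norm x \<le> norm (x + c *\<^sub>R y) + e" .
    qed
  qed (use off_line in blast)
  then show ?thesis by (simp add: birkhoff_james_def)
qed

text \<open>Orthogonality would bound by 1/2 all scale factors along \<open>x0 + c y0\<close>. Off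
  the line of \<open>x0\<close> the representatives are unit vectors, which forces a larger factor
  when \<open>x0 + c y0\<close> has norm below 2.\<close>

lemma not_orthogonal_half:
  fixes x0 y0 :: "'a::real_normed_vector"
  assumes A: "admissible A" and x0: "norm x0 = 1" and half: "(1/2) *\<^sub>R x0 \<in> A"
    and A_cases: "\<And>a. a \<in> A \<Longrightarrow> a = (1/2) *\<^sub>R x0 \<or> norm a = 1 \<and> (\<forall>t. a \<noteq> t *\<^sub>R x0)"
    and y0: "y0 \<noteq> 0" "\<And>t. y0 \<noteq> t *\<^sub>R x0"
  shows "\<not> orthogonal_wrt euclidean dual_unit_sphere A x0 y0"
proof
  assume orth: "orthogonal_wrt euclidean dual_unit_sphere A x0 y0"
  have nz: "x0 \<noteq> 0" using x0 by auto
  have rep: "representative A x0 = (1/2) *\<^sub>R x0"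
  proof (rule representative_eq(3)[OF A nz half])
    show "((1/2) *\<^sub>R x0, x0) \<in> proj_rel"
      using nz by (auto simp: proj_rel_def intro: exI[of _ "1/2"])
  qed
  \<comment> \<open>This gives \<open>c y0\<close> norm 1/2; any norm strictly between 0 and 1 would
    yield the same contradiction.\<close>
  define c where "c = 1 / (2 * norm y0)"
  define z where "z = x0 + c *\<^sub>R y0"
  have c: "c \<noteq> 0" using y0 by (simp add: c_def)
  have z_line: "z \<noteq> t *\<^sub>R x0" for t
  proof
    assume "z = t *\<^sub>R x0"
    then have "c *\<^sub>R y0 = (t - 1) *\<^sub>R x0" by (simp add: z_def algebra_simps)
    then show False using y0(2) c by (metis eq_vector_fraction_iff)
  qed
  then have "z \<noteq> 0" by (metis scaleR_zero_left)
  then obtain r where r: "r \<noteq> 0" "r *\<^sub>R z \<in> A"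
    using admissible_scaleR[OF A] by blast
  have "r *\<^sub>R z \<noteq> (1/2) *\<^sub>R x0"
    using z_line r(1) by (metis eq_vector_fraction_iff)
  then have "norm (r *\<^sub>R z) = 1" using A_cases r(2) by blast
  moreover have "\<bar>r\<bar> \<le> \<bar>1/2\<bar>"
    by (rule orthogonal_representative_scale_le[OF A nz y0(1) orth rep])
      (use r(2) in \<open>auto simp: z_def\<close>)
  moreover have "norm z \<le> norm x0 + norm (c *\<^sub>R y0)"
    unfolding z_def by (rule norm_triangle_ineq)
  then have "norm z \<le> 3/2" using x0 y0 by (simp add: c_def)
  ultimately have "1 \<le> 1/2 * (3/2 :: real)"
    using mult_mono[of "\<bar>r\<bar>" "1/2" "norm z" "3/2"] by simp
  then show False by simp
qed

text \<open>Dimension greater than one is expressed by a Hamel basis. Since \<open>card\<close> is 0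
  on infinite sets, the bound is imposed only on finite bases. The topology \<open>euclidean\<close>
  is the norm topology.\<close>

theorem theorem2p2:
  assumes "\<exists>B :: 'a::banach set. independent B \<and> span B = UNIV \<and> (finite B \<longrightarrow> card B > 1)"
  shows "\<exists>A :: 'a set. admissible A
    \<and> orthogonal_pairs euclidean dual_unit_sphere A \<subset> birkhoff_james_pairs
    \<and> \<not> (\<forall>x y :: 'a. orthogonal_wrt euclidean dual_unit_sphere A x y \<longleftrightarrow> birkhoff_james x y)"
proof -
  obtain x0 y0 :: 'a where x0: "norm x0 = 1" and y0: "y0 \<noteq> 0" "\<And>t. y0 \<noteq> t *\<^sub>R x0"
    and bj: "birkhoff_james x0 y0"
    using assms ex_birkhoff_james_unit by metis
  have "x0 \<noteq> 0" using x0 by auto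
  then obtain A where A: "admissible A" and half: "(1/2) *\<^sub>R x0 \<in> A"
    and A_cases: "\<And>a. a \<in> A \<Longrightarrow> a = (1/2) *\<^sub>R x0 \<or> norm a = 1 \<and> (\<forall>t. a \<noteq> t *\<^sub>R x0)"
    by (rule ex_admissible_half) blast
  have "birkhoff_james x y" if "orthogonal_wrt euclidean dual_unit_sphere A x y" for x y
    using orthogonal_imp_birkhoff_james[OF A x0 A_cases that] .
  then have sub: "orthogonal_pairs euclidean dual_unit_sphere A \<subseteq> birkhoff_james_pairs"
    by (auto simp: orthogonal_pairs_def birkhoff_james_pairs_def)
  have not_orth: "\<not> orthogonal_wrt euclidean dual_unit_sphere A x0 y0"
    using not_orthogonal_half[OF A x0 half A_cases y0] .
  \<comment> \<open>This one pair witnesses both the strictness of the inclusion and the failure of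
    the equivalence.\<close>
  then have "(x0, y0) \<in> birkhoff_james_pairs - orthogonal_pairs euclidean dual_unit_sphere A"
    using bj by (simp add: orthogonal_pairs_def birkhoff_james_pairs_def)
  with A sub not_orth bj show ?thesis by blast
qed

end
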